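(* There exists an $\mathrm{MSO}$ interpretation $\Theta$ such that $\Theta(\mathsf{Power}\text{-}\mathsf{graphs})$ contains (isomorphic copies of) all square grids.
   Context: For $n\ge1$, $D_n$ is the graph with vertex set $\{1,\dots,n\}$ in which $i$ and $j$ are adjacent iff either $|i-j|=1$, or $i\neq j$ and the largest power of $2$ dividing $i$ equals the largest power of $2$ dividing $j$. $\mathsf{Power}\text{-}\mathsf{graphs}$ is the class of all graphs isomorphic to an induced subgraph of some $D_n$. An $\mathrm{MSO}$ interpretation with parameters $\bar Z$ (set variables) is a pair $\Psi(\bar Z)=(\psi(x,\bar Z),\psi_E(x,y,\bar Z))$ of $\mathrm{MSO}$ formulas over graphs; for a graph $G$ and subsets $\bar A$ of $V(G)$, $\Psi((G,\bar A))$ has vertex set $\{a:G\models\psi(a,\bar A)\}$ and edge relation $\{(a,b):G\models\psi_E(a,b,\bar A)\}$, and $\Psi(\mathcal{C})=\{\Psi((G,\bar A)): G\in\mathcal{C}, \bar A \text{ arbitrary}\}$. The $n\times n$ grid has vertices $(i,j)$, $1\le i,j\le n$, with $(i,j)$ adjacent to $(i,j+1)$ and $(i+1,j)$ when these exist. *)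

theory Defs
  imports
    "HOL-Computational_Algebra.Primes"
    "Graph_Theory.Digraph_Isomorphism"
begin

text \<open>
  An undirected graph is a \<^typ>\<open>'a pair_pre_digraph\<close> whose arc set is symmetric and irreflexive
  (\<^const>\<open>pair_graph\<close>); an edge between \<open>u\<close> and \<open>v\<close> is the pair of arcs \<open>(u, v)\<close>, \<open>(v, u)\<close>.
\<close>

definition power_graph :: "nat \<Rightarrow> nat pair_pre_digraph" where
  "power_graph n = \<lparr> pverts = {1..n},
     parcs = {(i, j). i \<in> {1..n} \<and> j \<in> {1..n} \<and>
       (\<bar>int i - int j\<bar> = 1 \<or>
        i \<noteq> j \<and> (2::nat) ^ multiplicity 2 i = 2 ^ multiplicity 2 j)} \<rparr>"

definition Power_graphs :: "'a pair_pre_digraph set" where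
  "Power_graphs = {G. \<exists>n\<ge>1. \<exists>H :: nat pair_pre_digraph.
     induced_subgraph (with_proj H) (with_proj (power_graph n)) \<and>
     digraph_iso (with_proj H) (with_proj G)}"

definition square_grid :: "nat \<Rightarrow> (nat \<times> nat) pair_pre_digraph" where
  "square_grid n = \<lparr> pverts = {1..n} \<times> {1..n},
     parcs = {((i, j), (k, l)). (i, j) \<in> {1..n} \<times> {1..n} \<and> (k, l) \<in> {1..n} \<times> {1..n} \<and>
       ((k, l) = (i, j + 1) \<or> (k, l) = (i + 1, j) \<or>
        (i, j) = (k, l + 1) \<or> (i, j) = (k + 1, l))} \<rparr>"

text \<open>
  Monadic second-order formulas over the vocabulary of graphs. Element variables and set variables
  are separately named by natural numbers. The remaining connectives and the universal quantifiers
  are expressible by duality.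
\<close>

datatype mso =
    Eq nat nat
  | Edge nat nat
  | Mem nat nat  \<comment> \<open>element variable, set variable\<close>
  | Neg mso
  | Conj mso mso
  | ExElem nat mso
  | ExSet nat mso

primrec free_elems :: "mso \<Rightarrow> nat set" where
  "free_elems (Eq x y) = {x, y}"
| "free_elems (Edge x y) = {x, y}"
| "free_elems (Mem x X) = {x}"
| "free_elems (Neg \<phi>) = free_elems \<phi>"
| "free_elems (Conj \<phi> \<psi>) = free_elems \<phi> \<union> free_elems \<psi>"
| "free_elems (ExElem x \<phi>) = free_elems \<phi> - {x}"
| "free_elems (ExSet X \<phi>) = free_elems \<phi>"

primrec free_sets :: "mso \<Rightarrow> nat set" where
  "free_sets (Eq x y) = {}"
| "free_sets (Edge x y) = {}"
| "free_sets (Mem x X) = {X}"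
| "free_sets (Neg \<phi>) = free_sets \<phi>"
| "free_sets (Conj \<phi> \<psi>) = free_sets \<phi> \<union> free_sets \<psi>"
| "free_sets (ExElem x \<phi>) = free_sets \<phi>"
| "free_sets (ExSet X \<phi>) = free_sets \<phi> - {X}"

primrec sat :: "'a pair_pre_digraph \<Rightarrow> (nat \<Rightarrow> 'a) \<Rightarrow> (nat \<Rightarrow> 'a set) \<Rightarrow> mso \<Rightarrow> bool" where
  "sat G v V (Eq x y) \<longleftrightarrow> v x = v y"
| "sat G v V (Edge x y) \<longleftrightarrow> (v x, v y) \<in> parcs G"
| "sat G v V (Mem x X) \<longleftrightarrow> v x \<in> V X"
| "sat G v V (Neg \<phi>) \<longleftrightarrow> \<not> sat G v V \<phi>"
| "sat G v V (Conj \<phi> \<psi>) \<longleftrightarrow> sat G v V \<phi> \<and> sat G v V \<psi>"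
| "sat G v V (ExElem x \<phi>) \<longleftrightarrow> (\<exists>a \<in> pverts G. sat G (v(x := a)) V \<phi>)"
| "sat G v V (ExSet X \<phi>) \<longleftrightarrow> (\<exists>A \<subseteq> pverts G. sat G v (V(X := A)) \<phi>)"

text \<open>
  In an interpretation, the element variables \<open>0\<close> and \<open>1\<close> play the roles of \<open>x\<close> and \<open>y\<close>, and the
  set variables below \<open>num_params\<close> are the parameters.
\<close>

record mso_interp =
  num_params :: nat
  vert_formula :: mso
  edge_formula :: mso

definition mso_interpretation :: "mso_interp \<Rightarrow> bool" where
  "mso_interpretation \<Psi> \<longleftrightarrow>
     free_elems (vert_formula \<Psi>) \<subseteq> {0} \<and>
     free_elems (edge_formula \<Psi>) \<subseteq> {0, 1} \<and>
     free_sets (vert_formula \<Psi>) \<subseteq> {..<num_params \<Psi>} \<and>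
     free_sets (edge_formula \<Psi>) \<subseteq> {..<num_params \<Psi>}"

definition interp_verts ::
    "mso_interp \<Rightarrow> 'a pair_pre_digraph \<Rightarrow> (nat \<Rightarrow> 'a set) \<Rightarrow> 'a set" where
  "interp_verts \<Psi> G A = {a \<in> pverts G. sat G (\<lambda>_. a) A (vert_formula \<Psi>)}"

definition interp_graph ::
    "mso_interp \<Rightarrow> 'a pair_pre_digraph \<Rightarrow> (nat \<Rightarrow> 'a set) \<Rightarrow> 'a pair_pre_digraph" where
  "interp_graph \<Psi> G A = \<lparr> pverts = interp_verts \<Psi> G A,
     parcs = {(a, b). a \<in> interp_verts \<Psi> G A \<and> b \<in> interp_verts \<Psi> G A \<and>
       sat G (\<lambda>x. if x = 0 then a else b) A (edge_formula \<Psi>)} \<rparr>"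

definition interp_class ::
    "mso_interp \<Rightarrow> 'a pair_pre_digraph set \<Rightarrow> 'a pair_pre_digraph set" where
  "interp_class \<Psi> C = {interp_graph \<Psi> G A | G A.
     G \<in> C \<and> (\<forall>i < num_params \<Psi>. A i \<subseteq> pverts G)}"

lemma sat_cong:
  assumes "\<And>x. x \<in> free_elems \<phi> \<Longrightarrow> v x = v' x" "\<And>X. X \<in> free_sets \<phi> \<Longrightarrow> V X = V' X"
  shows "sat G v V \<phi> \<longleftrightarrow> sat G v' V' \<phi>"
  using assms
proof (induction \<phi> arbitrary: v v' V V')
  case (Conj \<phi> \<psi>)
  have "sat G v V \<phi> = sat G v' V' \<phi>" "sat G v V \<psi> = sat G v' V' \<psi>"
    by (rule Conj.IH; use Conj.prems in simp)+
  then show ?case by simp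
next
  case (ExElem x \<phi>)
  have "sat G (v(x := a)) V \<phi> = sat G (v'(x := a)) V' \<phi>" for a
    by (rule ExElem.IH) (use ExElem.prems in auto)
  then show ?case by simp
next
  case (ExSet X \<phi>)
  have "sat G v (V(X := A)) \<phi> = sat G v' (V'(X := A)) \<phi>" for A
    by (rule ExSet.IH) (use ExSet.prems in auto)
  then show ?case by simp
next
  case (Neg \<phi>)
  have "sat G v V \<phi> = sat G v' V' \<phi>" by (rule Neg.IH) (use Neg.prems in auto)
  then show ?case by simp
qed auto

lemma pair_graph_power_graph: "pair_graph (power_graph n)"
proof -
  have "finite (parcs (power_graph n))"
    by (rule finite_subset[of _ "{1..n} \<times> {1..n}"]) (auto simp: power_graph_def)
  then show ?thesis
    by unfold_locales (auto simp: power_graph_def symmetric_def sym_def)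
qed

lemma pair_graph_square_grid: "pair_graph (square_grid n)"
proof -
  have "finite (parcs (square_grid n))"
    by (rule finite_subset[of _ "({1..n} \<times> {1..n}) \<times> ({1..n} \<times> {1..n})"])
      (auto simp: square_grid_def)
  then show ?thesis
    by unfold_locales (auto simp: square_grid_def symmetric_def sym_def)
qed

text \<open>
  On graphs given by pairs, \<^const>\<open>digraph_iso\<close> is the usual existence of a vertex bijection that
  preserves and reflects adjacency.
\<close>

lemma digraph_iso_pair_iff:
  fixes G :: "'a pair_pre_digraph" and H :: "'b pair_pre_digraph"
  assumes G: "pair_wf_digraph G" and H: "pair_wf_digraph H"
  shows "digraph_iso (with_proj G) (with_proj H) \<longleftrightarrow>
    (\<exists>f. bij_betw f (pverts G) (pverts H) \<and>
      (\<forall>u\<in>pverts G. \<forall>v\<in>pverts G. (u, v) \<in> parcs G \<longleftrightarrow> (f u, f v) \<in> parcs H))"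
    (is "?L \<longleftrightarrow> ?R")
proof
  assume ?L
  then obtain h where h: "pre_digraph.digraph_isomorphism (with_proj G) h"
    and eq: "with_proj H = app_iso h (with_proj G)"
    unfolding digraph_iso_def by blast
  let ?f = "iso_verts h"
  have V: "pverts H = ?f ` pverts G" and A: "parcs H = iso_arcs h ` parcs G"
    and T: "iso_tail h = fst" and D: "iso_head h = snd"
    using eq by (auto simp: app_iso_def with_proj_def)
  have inj: "inj_on ?f (pverts G)"
    using h by (simp add: pre_digraph.digraph_isomorphism_def)
  have arc: "iso_arcs h e = (?f (fst e), ?f (snd e))" if "e \<in> parcs G" for e
    using h that T D by (simp add: pre_digraph.digraph_isomorphism_def prod_eq_iff)
  have "(u, v) \<in> parcs G \<longleftrightarrow> (?f u, ?f v) \<in> parcs H"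
    if uv: "u \<in> pverts G" "v \<in> pverts G" for u v
  proof
    assume "(u, v) \<in> parcs G"
    then show "(?f u, ?f v) \<in> parcs H" using A arc by force
  next
    assume "(?f u, ?f v) \<in> parcs H"
    then obtain e where e: "e \<in> parcs G" "(?f u, ?f v) = (?f (fst e), ?f (snd e))"
      using A arc by auto
    moreover have "fst e \<in> pverts G" "snd e \<in> pverts G"
      using G e(1) unfolding pair_wf_digraph_def by blast+
    ultimately have "u = fst e" "v = snd e"
      using inj uv by (auto dest: inj_onD)
    then show "(u, v) \<in> parcs G" using e(1) by simp
  qed
  then show ?R using inj V by (auto simp: bij_betw_def intro!: exI[of _ ?f])
next
  assume ?R
  then obtain f where f: "bij_betw f (pverts G) (pverts H)"
    and fa: "\<And>u v. u \<in> pverts G \<Longrightarrow> v \<in> pverts G \<Longrightarrow>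
      (u, v) \<in> parcs G \<longleftrightarrow> (f u, f v) \<in> parcs H" by blast
  have GV: "u \<in> pverts G \<and> v \<in> pverts G" if "(u, v) \<in> parcs G" for u v
    using G that by (force simp: pair_wf_digraph_def)
  have HV: "u \<in> pverts H \<and> v \<in> pverts H" if "(u, v) \<in> parcs H" for u v
    using H that by (force simp: pair_wf_digraph_def)
  define h where "h = \<lparr> iso_verts = f, iso_arcs = map_prod f f, iso_head = snd, iso_tail = fst \<rparr>"
  have wf: "wf_digraph (with_proj G)"
    using GV by unfold_locales auto
  have inj: "inj_on f (pverts G)" using f by (simp add: bij_betw_def)
  have "inj_on (map_prod f f) (parcs G)"
    using GV inj by (auto simp: inj_on_def)
  then have iso: "pre_digraph.digraph_isomorphism (with_proj G) h"
    using wf inj by (auto simp: pre_digraph.digraph_isomorphism_def h_def)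
  have "parcs H = map_prod f f ` parcs G"
  proof (intro set_eqI iffI)
    fix e assume e: "e \<in> parcs H"
    obtain a b where ab: "e = (a, b)" by fastforce
    with HV e f obtain u v where "u \<in> pverts G" "v \<in> pverts G" "a = f u" "b = f v"
      unfolding bij_betw_def by (metis imageE)
    with fa e ab show "e \<in> map_prod f f ` parcs G" by force
  qed (use fa GV in auto)
  then have "with_proj H = app_iso h (with_proj G)"
    using f by (simp add: app_iso_def with_proj_def h_def bij_betw_def)
  with iso show ?L unfolding digraph_iso_def by blast
qed

end

theory Submission
  imports Defs
begin

text \<open>
  The grid vertex \<open>(p, q)\<close> is placed at the number \<open>p * 2 ^ m + 2 ^ q\<close> with \<open>q < m\<close>, whose 2-adic
  valuation is \<open>q\<close>. Marking the odd numbers separates the two kinds of edges of \<^term>\<open>power_graph N\<close>: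
  an edge joins numbers of opposite parity iff they are consecutive. So MSO can express that every
  number strictly between \<open>x\<close> and \<open>y\<close> has a definable property. Then \<open>(p, q)\<close> and \<open>(p, q + 1)\<close> are
  recognised as consecutive marked numbers, where multiples of \<open>2 ^ m\<close> are marked as separators, and
  \<open>(p, q)\<close> and \<open>(p + 1, q)\<close> as consecutive grid vertices among those of a common valuation.
\<close>

section \<open>The formulas of the interpretation\<close>

definition Disj :: "mso \<Rightarrow> mso \<Rightarrow> mso" where
  "Disj \<phi> \<psi> = Neg (Conj (Neg \<phi>) (Neg \<psi>))"

lemma Disj_simps [simp]:
  "sat G v V (Disj \<phi> \<psi>) \<longleftrightarrow> sat G v V \<phi> \<or> sat G v V \<psi>"
  "free_elems (Disj \<phi> \<psi>) = free_elems \<phi> \<union> free_elems \<psi>"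
  "free_sets (Disj \<phi> \<psi>) = free_sets \<phi> \<union> free_sets \<psi>"
  by (auto simp: Disj_def)

text \<open>Set variable \<open>0\<close> is meant to hold the odd numbers, so that the disjunction
  demands opposite parity.\<close>

definition path_edge :: "nat \<Rightarrow> nat \<Rightarrow> mso" where
  "path_edge x y = Conj (Edge x y)
     (Disj (Conj (Mem x 0) (Neg (Mem y 0))) (Conj (Mem y 0) (Neg (Mem x 0))))"

text \<open>
  Every set that contains \<open>x\<close> and is closed under path steps out of \<open>x\<close> and out of the vertices
  satisfying \<open>\<phi>\<close> also contains \<open>y\<close>. Element variables: \<open>x = 0\<close>, \<open>y = 1\<close>; \<open>\<phi>\<close> speaks about variable
  \<open>2\<close> and may refer to \<open>x\<close>.
\<close>

definition reach :: "mso \<Rightarrow> mso" where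
  "reach \<phi> = Neg (ExSet 3 (Conj (Mem 0 3) (Conj (Neg (Mem 1 3))
     (Neg (ExElem 2 (ExElem 3 (Conj (Conj (Mem 2 3) (Neg (Mem 3 3)))
       (Conj (path_edge 2 3) (Disj (Eq 2 0) \<phi>)))))))))"

text \<open>Set variable \<open>2\<close> is meant to hold the grid vertices and the
  separators.\<close>

definition row_edge :: mso where
  "row_edge = Conj (Neg (Eq 0 1)) (reach (Neg (Mem 2 2)))"

text \<open>Set variable \<open>1\<close> is meant to hold the grid vertices. These are all even, so
  an edge between two of them means equal valuation.\<close>

definition column_edge :: mso where
  "column_edge = Conj (Edge 0 1) (reach (Neg (Conj (Mem 2 1) (Edge 0 2))))"

definition grid_interp :: mso_interp where
  "grid_interp = \<lparr> num_params = 3, vert_formula = Mem 0 1,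
     edge_formula = Disj row_edge column_edge \<rparr>"

lemma mso_interpretation_grid_interp: "mso_interpretation grid_interp"
  by (auto simp: mso_interpretation_def grid_interp_def row_edge_def column_edge_def reach_def
      path_edge_def)

section \<open>Intervals described by sets closed under unit steps\<close>

definition strictly_between :: "nat \<Rightarrow> nat \<Rightarrow> nat set" where
  "strictly_between x y = {x<..<y} \<union> {y<..<x}"

lemma strictly_between_commute: "strictly_between x y = strictly_between y x"
  by (auto simp: strictly_between_def)

text \<open>A step from \<open>u\<close> to \<open>v\<close> either leads away from \<open>x\<close>
  and adds at most \<open>u\<close> to the interval, or leads towards \<open>x\<close> and shrinks
  it. Removing \<open>x\<close> covers the first step, where \<open>u = x\<close> and
  \<open>P u\<close> may fail.\<close>

lemma strictly_between_step:
  assumes "\<bar>int u - int v\<bar> = 1"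
  shows "strictly_between x v \<subseteq> insert u (strictly_between x u) - {x}"
proof -
  have "v = Suc u \<or> u = Suc v" using assms by linarith
  then show ?thesis by (auto simp: strictly_between_def)
qed

text \<open>From left to right, \<open>Y\<close> is taken to be the set of all \<open>z\<close> such
  that \<open>P\<close> holds strictly between \<open>x\<close> and \<open>z\<close>. From right to
  left, one walks from \<open>x\<close> to \<open>y\<close> in unit steps: each number departed from
  is \<open>x\<close> itself or satisfies \<open>P\<close>.\<close>

lemma closed_iff_strictly_between:
  fixes x y N :: nat
  assumes x: "x \<in> {1..N}" and y: "y \<in> {1..N}"
  shows "(\<forall>Y\<subseteq>{1..N}. x \<in> Y \<longrightarrow>
      (\<forall>u\<in>{1..N}. \<forall>v\<in>{1..N}. u \<in> Y \<longrightarrow> \<bar>int u - int v\<bar> = 1 \<longrightarrow> u = x \<or> P u \<longrightarrow> v \<in> Y) \<longrightarrow> y \<in> Y)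
    \<longleftrightarrow> (\<forall>z\<in>strictly_between x y. P z)" (is "?L \<longleftrightarrow> ?R")
proof
  assume L: ?L
  let ?Y = "{z \<in> {1..N}. \<forall>w\<in>strictly_between x z. P w}"
  have step: "v \<in> ?Y" if "v \<in> {1..N}" "u \<in> ?Y" "\<bar>int u - int v\<bar> = 1" "u = x \<or> P u" for u v
  proof -
    have "P w" if "w \<in> strictly_between x v" for w
      using that strictly_between_step[OF \<open>\<bar>int u - int v\<bar> = 1\<close>, of x]
        \<open>u \<in> ?Y\<close> \<open>u = x \<or> P u\<close> by fast
    then show ?thesis using \<open>v \<in> {1..N}\<close> by simp
  qed
  have "x \<in> ?Y" using x by (auto simp: strictly_between_def)
  then have "y \<in> ?Y" by - (rule L[rule_format, of ?Y], rule Collect_restrict, assumption, rule step)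
  then show ?R by simp
next
  assume R: ?R
  show ?L
  proof (intro allI impI)
    fix Y assume xY: "x \<in> Y"
      and *: "\<forall>u\<in>{1..N}. \<forall>v\<in>{1..N}. u \<in> Y \<longrightarrow> \<bar>int u - int v\<bar> = 1 \<longrightarrow> u = x \<or> P u \<longrightarrow> v \<in> Y"
    have closed: "v \<in> Y" if "u \<in> {1..N}" "v \<in> {1..N}" "u \<in> Y" "\<bar>int u - int v\<bar> = 1"
      "u = x \<or> P u" for u v
      by (rule *[rule_format, OF that])
    have up: "x + d \<in> Y" if "x + d \<le> y" for d
      using that
    proof (induction d)
      case (Suc d)
      then have "x + d = x \<or> P (x + d)" using R by (auto simp: strictly_between_def)
      moreover have "x + d \<in> Y" using Suc by simp
      moreover have "\<bar>int (x + d) - int (x + Suc d)\<bar> = 1" using Suc.prems by simp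
      moreover have "x + d \<in> {1..N}" "x + Suc d \<in> {1..N}" using Suc.prems x y by simp_all
      ultimately show ?case by - (rule closed[of "x + d"])
    qed (use xY in simp)
    \<comment> \<open>The bound \<open>y + d \<le> x\<close> keeps the truncated subtraction
      exact.\<close>
    have down: "x - d \<in> Y" if "y + d \<le> x" for d
      using that
    proof (induction d)
      case (Suc d)
      then have "x - d = x \<or> x - d \<in> strictly_between x y"
        by (auto simp: strictly_between_def)
      then have "x - d = x \<or> P (x - d)" using R by blast
      moreover have "x - d \<in> Y" using Suc by simp
      moreover have "\<bar>int (x - d) - int (x - Suc d)\<bar> = 1" using Suc.prems by simp
      moreover have "x - d \<in> {1..N}" "x - Suc d \<in> {1..N}" using Suc.prems x y by auto
      ultimately show ?case by - (rule closed[of "x - d"])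
    qed (use xY in simp)
    show "y \<in> Y" using up[of "y - x"] down[of "x - y"] by (cases "x \<le> y") auto
  qed
qed

section \<open>Meaning of the formulas in power graphs\<close>

lemma power_graph_simps [simp]:
  "pverts (power_graph N) = {1..N}"
  "(x, y) \<in> parcs (power_graph N) \<longleftrightarrow> x \<in> {1..N} \<and> y \<in> {1..N} \<and>
     (\<bar>int x - int y\<bar> = 1 \<or> x \<noteq> y \<and> multiplicity 2 x = multiplicity 2 y)"
  by (auto simp: power_graph_def)

text \<open>A positive number is odd iff its valuation is \<open>0\<close>; positivity matters
  because \<open>multiplicity 2 0 = 0\<close>.\<close>

lemma even_iff_of_multiplicity_eq:
  fixes x y :: nat
  assumes "multiplicity 2 x = multiplicity 2 y" "x > 0" "y > 0"
  shows "even x \<longleftrightarrow> even y"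
  using assms multiplicity_eq_zero_iff[of x "2::nat"] multiplicity_eq_zero_iff[of y "2::nat"]
  by simp

lemma sat_path_edge:
  assumes "V 0 = {x \<in> {1..N}. odd x}" "v x \<in> {1..N}" "v y \<in> {1..N}"
  shows "sat (power_graph N) v V (path_edge x y) \<longleftrightarrow> \<bar>int (v x) - int (v y)\<bar> = 1"
proof -
  have "odd (v x) \<noteq> odd (v y)" if "\<bar>int (v x) - int (v y)\<bar> = 1"
  proof -
    have "v x = Suc (v y) \<or> v y = Suc (v x)" using that by linarith
    then show ?thesis by auto
  qed
  then show ?thesis
    using assms even_iff_of_multiplicity_eq[of "v x" "v y"]
    by (auto simp: path_edge_def)
qed

text \<open>Unfolding yields the closure condition of \<open>closed_iff_strictly_between\<close>.
  The bounds on free variables prevent capture by element variable \<open>3\<close> and set variable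
  \<open>3\<close>, which \<open>reach\<close> binds.\<close>

lemma sat_reach:
  assumes V: "V 0 = {x \<in> {1..N}. odd x}" and x: "v 0 \<in> {1..N}" and y: "v 1 \<in> {1..N}"
    and fv: "free_elems \<phi> \<subseteq> {0, 2}" "free_sets \<phi> \<subseteq> {..<3}"
  shows "sat (power_graph N) v V (reach \<phi>) \<longleftrightarrow>
    (\<forall>z\<in>strictly_between (v 0) (v 1). sat (power_graph N) (v(2 := z)) V \<phi>)"
proof -
  have \<phi>: "sat (power_graph N) (v(2 := a, 3 := b)) (V(3 := Y)) \<phi> \<longleftrightarrow>
      sat (power_graph N) (v(2 := a)) V \<phi>" for a b Y
    using fv by (intro sat_cong) auto
  have step: "sat (power_graph N) (v(2 := a, 3 := b)) (V(3 := Y)) (path_edge 2 3) \<longleftrightarrow>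
      \<bar>int a - int b\<bar> = 1" if "a \<in> {1..N}" "b \<in> {1..N}" for a b Y
    using that V by (subst sat_path_edge) auto
  have "sat (power_graph N) v V (reach \<phi>) \<longleftrightarrow> (\<forall>Y\<subseteq>{1..N}. v 0 \<in> Y \<longrightarrow>
      (\<forall>a\<in>{1..N}. \<forall>b\<in>{1..N}. a \<in> Y \<longrightarrow>
        sat (power_graph N) (v(2 := a, 3 := b)) (V(3 := Y)) (path_edge 2 3) \<longrightarrow>
        a = v 0 \<or> sat (power_graph N) (v(2 := a)) V \<phi> \<longrightarrow> b \<in> Y) \<longrightarrow> v 1 \<in> Y)"
    unfolding reach_def by (simp add: \<phi>) blast
  also have "\<dots> \<longleftrightarrow> (\<forall>Y\<subseteq>{1..N}. v 0 \<in> Y \<longrightarrow>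
      (\<forall>a\<in>{1..N}. \<forall>b\<in>{1..N}. a \<in> Y \<longrightarrow> \<bar>int a - int b\<bar> = 1 \<longrightarrow>
        a = v 0 \<or> sat (power_graph N) (v(2 := a)) V \<phi> \<longrightarrow> b \<in> Y) \<longrightarrow> v 1 \<in> Y)"
    by (simp only: step cong: ball_cong)
  also have "\<dots> \<longleftrightarrow> (\<forall>z\<in>strictly_between (v 0) (v 1). sat (power_graph N) (v(2 := z)) V \<phi>)"
    by (rule closed_iff_strictly_between[OF x y])
  finally show ?thesis .
qed

section \<open>Order and valuation of grid codes\<close>

definition grid_code :: "nat \<Rightarrow> nat \<times> nat \<Rightarrow> nat" where
  "grid_code m = (\<lambda>(p, q). p * 2 ^ m + 2 ^ q)"

text \<open>The offset \<open>2 ^ q\<close> is smaller than the block length \<open>2 ^ m\<close>,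
  so the first coordinate dominates.\<close>

lemma grid_code_less_iff:
  assumes "q < m" "q' < m"
  shows "grid_code m (p, q) < grid_code m (p', q') \<longleftrightarrow> p < p' \<or> p = p' \<and> q < q'"
proof -
  have lt: "grid_code m (a, b) < grid_code m (c, d)" if "a < c" "b < m" for a b c d
  proof -
    have "a * 2 ^ m + 2 ^ m \<le> c * (2::nat) ^ m"
      using that(1) by (metis Suc_leI add.commute mult_Suc mult_le_mono1)
    moreover have "(2::nat) ^ b < 2 ^ m" using that(2) by simp
    ultimately show ?thesis unfolding grid_code_def prod.case by linarith
  qed
  show ?thesis
    using lt[of p p' q q'] lt[of p' p q' q] assms
    by (cases p p' rule: linorder_cases) (auto simp: grid_code_def)
qed

lemma grid_code_eq_iff:
  assumes "q < m" "q' < m"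
  shows "grid_code m (p, q) = grid_code m (p', q') \<longleftrightarrow> p = p' \<and> q = q'"
  using grid_code_less_iff[OF assms, of p p'] grid_code_less_iff[OF assms(2,1), of p' p]
  by (metis linorder_cases less_irrefl)

text \<open>Factoring out \<open>2 ^ q\<close> leaves \<open>p * 2 ^ (m - q) + 1\<close>, which is
  odd because \<open>q < m\<close>.\<close>

lemma multiplicity_grid_code:
  assumes "q < m"
  shows "multiplicity 2 (grid_code m (p, q)) = q"
proof -
  have "grid_code m (p, q) = 2 ^ q * (p * 2 ^ (m - q) + 1)"
    using assms by (simp add: grid_code_def algebra_simps flip: power_add)
  moreover have "\<not> 2 dvd (p * 2 ^ (m - q) + 1 :: nat)" using assms by simp
  ultimately have "2 ^ q dvd grid_code m (p, q)" "\<not> 2 ^ Suc q dvd grid_code m (p, q)"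
    by (simp_all only: power_Suc2 nat_mult_dvd_cancel_disj dvd_triv_left) simp_all
  then show ?thesis by (rule multiplicity_eqI)
qed

text \<open>Grid indices start at 1, so this covers all grid vertices: no two of them are
  consecutive numbers.\<close>

lemma even_grid_code: "0 < q \<Longrightarrow> q < m \<Longrightarrow> even (grid_code m (p, q))"
  by (simp add: grid_code_def)

section \<open>Marked numbers and grid neighbours\<close>

lemma square_grid_simps [simp]:
  "pverts (square_grid n) = {1..n} \<times> {1..n}"
  "((i, j), (k, l)) \<in> parcs (square_grid n) \<longleftrightarrow>
     i \<in> {1..n} \<and> j \<in> {1..n} \<and> k \<in> {1..n} \<and> l \<in> {1..n} \<and>
       ((k, l) = (i, j + 1) \<or> (k, l) = (i + 1, j) \<or> (i, j) = (k, l + 1) \<or> (i, j) = (k + 1, l))"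
  by (auto simp: square_grid_def)

text \<open>The block exponent is \<open>Suc n\<close> because \<open>q\<close> runs up to
  \<open>n\<close> and has to stay below it.\<close>

definition grid_codes :: "nat \<Rightarrow> nat set" where
  "grid_codes n = grid_code (Suc n) ` ({1..n} \<times> {1..n})"

text \<open>Each separator opens the block of one \<open>p\<close>; it keeps the last code of a
  block and the first code of the next from being consecutive marks.\<close>

definition separators :: "nat \<Rightarrow> nat set" where
  "separators n = (\<lambda>p. p * 2 ^ Suc n) ` {1..n}"

lemma separator_less_grid_code:
  assumes "q < m"
  shows "r * 2 ^ m < grid_code m (p, q) \<longleftrightarrow> r \<le> p"
    and "grid_code m (p, q) < r * 2 ^ m \<longleftrightarrow> p < r"
proof -
  have q: "(2::nat) ^ q < 2 ^ m" using assms by simp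
  have 1: "r * 2 ^ m \<le> p * 2 ^ m" if "r \<le> p" using that by simp
  have 2: "Suc p * 2 ^ m \<le> r * (2::nat) ^ m" if "p < r"
    using that by (intro mult_le_mono1) simp
  have lo: "r * 2 ^ m < grid_code m (p, q)" if "r \<le> p"
    using 1[OF that] zero_less_power[of "2::nat" q] unfolding grid_code_def prod.case by linarith
  have hi: "grid_code m (p, q) < r * 2 ^ m" if "p < r"
    using 2[OF that] q unfolding grid_code_def prod.case mult_Suc by linarith
  show "r * 2 ^ m < grid_code m (p, q) \<longleftrightarrow> r \<le> p" "grid_code m (p, q) < r * 2 ^ m \<longleftrightarrow> p < r"
    using lo hi by (meson leI less_asym)+
qed

lemma no_mark_strictly_between_iff:
  assumes "p \<in> {1..n}" "q \<in> {1..n}" "p' \<in> {1..n}" "q' \<in> {1..n}" "(p, q) \<noteq> (p', q')"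
  shows "strictly_between (grid_code (Suc n) (p, q)) (grid_code (Suc n) (p', q')) \<inter>
      (grid_codes n \<union> separators n) = {} \<longleftrightarrow> p = p' \<and> (q' = q + 1 \<or> q = q' + 1)"
    (is "?S (p, q) (p', q') \<inter> ?D = {} \<longleftrightarrow> _")
proof -
  \<comment> \<open>By symmetry, only lexicographically increasing pairs need to be treated.\<close>
  have *: "?S (p, q) (p', q') \<inter> ?D = {} \<longleftrightarrow> p = p' \<and> q' = q + 1"
    if pq: "p \<in> {1..n}" "q \<in> {1..n}" "p' \<in> {1..n}" "q' \<in> {1..n}" "p < p' \<or> p = p' \<and> q < q'"
    for p q p' q'
  proof
    assume empty: "?S (p, q) (p', q') \<inter> ?D = {}"
    have "p = p'"
    proof (rule ccontr)
      assume "p \<noteq> p'"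
      \<comment> \<open>The separator that opens block \<open>p'\<close> lies between the two
        codes.\<close>
      then have "p' * 2 ^ Suc n \<in> ?S (p, q) (p', q') \<inter> ?D"
        using pq
        by (auto simp: strictly_between_def separators_def separator_less_grid_code
            simp del: power_Suc)
      then show False using empty by blast
    qed
    moreover have "q' = q + 1"
    proof (rule ccontr)
      assume "q' \<noteq> q + 1"
      \<comment> \<open>Now \<open>q + 1 < q'\<close>, so the next code of the same block lies
        between.\<close>
      then have "grid_code (Suc n) (p, q + 1) \<in> ?S (p, q) (p', q')"
        using pq \<open>p = p'\<close> by (auto simp: strictly_between_def grid_code_less_iff)
      moreover have "grid_code (Suc n) (p, q + 1) \<in> ?D"
        using pq \<open>p = p'\<close> \<open>q' \<noteq> q + 1\<close> by (auto simp: grid_codes_def)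
      ultimately show False using empty by blast
    qed
    ultimately show "p = p' \<and> q' = q + 1" ..
  next
    assume "p = p' \<and> q' = q + 1"
    then show "?S (p, q) (p', q') \<inter> ?D = {}"
      using pq by (auto simp: strictly_between_def grid_codes_def separators_def
          grid_code_less_iff separator_less_grid_code simp del: power_Suc)
  qed
  consider "p < p' \<or> p = p' \<and> q < q'" | "p' < p \<or> p' = p \<and> q' < q"
    using assms(5) by fastforce
  then show ?thesis
  proof cases
    case 1
    then show ?thesis using *[OF assms(1-4)] by auto
  next
    case 2
    then show ?thesis
      using *[OF assms(3,4,1,2)] by (subst strictly_between_commute) auto
  qed
qed

text \<open>The grid vertices of valuation \<open>q\<close> are the codes of the pairs
  \<open>(r, q)\<close>, and these increase with \<open>r\<close>. The question thus reduces to
  numbers \<open>r\<close> strictly between \<open>p\<close> and \<open>p'\<close>.\<close>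

lemma no_equal_valuation_strictly_between_iff:
  assumes "p \<in> {1..n}" "q \<in> {1..n}" "p' \<in> {1..n}" "p \<noteq> p'"
  shows "(\<forall>z\<in>strictly_between (grid_code (Suc n) (p, q)) (grid_code (Suc n) (p', q)).
      \<not> (z \<in> grid_codes n \<and> multiplicity 2 z = q)) \<longleftrightarrow> p' = p + 1 \<or> p = p' + 1"
    (is "?L \<longleftrightarrow> ?R")
proof -
  have same_val: "z \<in> grid_codes n \<and> multiplicity 2 z = q \<longleftrightarrow>
      (\<exists>r\<in>{1..n}. z = grid_code (Suc n) (r, q))" for z
    using assms(2) multiplicity_grid_code[of _ "Suc n"]
    by (fastforce simp: grid_codes_def)
  have "?L \<longleftrightarrow> (\<forall>r\<in>{1..n}. r \<notin> strictly_between p p')"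
    using assms(2) unfolding same_val
    by (auto simp: strictly_between_def grid_code_less_iff)
  also have "\<dots> \<longleftrightarrow> ?R"
  proof
    assume *: "\<forall>r\<in>{1..n}. r \<notin> strictly_between p p'"
    \<comment> \<open>The possible obstruction is the successor of the smaller of \<open>p\<close>
      and \<open>p'\<close>.\<close>
    show ?R
      using *[rule_format, of "p + 1"] *[rule_format, of "p' + 1"] assms
      by (cases p p' rule: linorder_cases) (auto simp: strictly_between_def not_less intro: antisym)
  qed (auto simp: strictly_between_def)
  finally show ?thesis .
qed

section \<open>Parameters and correctness of the interpretation\<close>

definition grid_size :: "nat \<Rightarrow> nat" where
  "grid_size n = Suc n * 2 ^ Suc n"

definition grid_params :: "nat \<Rightarrow> nat \<Rightarrow> nat set" where
  "grid_params n = (\<lambda>_. {})(0 := {x \<in> {1..grid_size n}. odd x}, 1 := grid_codes n,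
     2 := grid_codes n \<union> separators n)"

text \<open>\<open>grid_size n\<close> is the multiple of \<open>2 ^ Suc n\<close> that follows the
  last block.\<close>

lemma grid_code_in_range:
  assumes "p \<in> {1..n}" "q \<in> {1..n}"
  shows "grid_code (Suc n) (p, q) \<in> {1..grid_size n}"
proof -
  have "grid_code (Suc n) (p, q) < grid_size n"
    unfolding grid_size_def using assms separator_less_grid_code(2)[of q "Suc n" p "Suc n"] by simp
  moreover have "0 < grid_code (Suc n) (p, q)" by (simp add: grid_code_def)
  ultimately show ?thesis by simp
qed

lemma grid_params_subset: "grid_params n i \<subseteq> {1..grid_size n}"
proof -
  have "separators n \<subseteq> {1..grid_size n}"
    by (auto simp: separators_def grid_size_def simp del: mult_Suc power_Suc intro!: mult_le_mono1)
  moreover have "grid_codes n \<subseteq> {1..grid_size n}"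
    using grid_code_in_range unfolding grid_codes_def by blast
  ultimately show ?thesis unfolding grid_params_def by auto
qed

lemma sat_grid_edge_iff:
  assumes pq: "p \<in> {1..n}" "q \<in> {1..n}" "p' \<in> {1..n}" "q' \<in> {1..n}"
    and v: "v 0 = grid_code (Suc n) (p, q)" "v 1 = grid_code (Suc n) (p', q')"
  shows "sat (power_graph (grid_size n)) v (grid_params n) (Disj row_edge column_edge) \<longleftrightarrow>
    ((p, q), (p', q')) \<in> parcs (square_grid n)"
proof -
  let ?N = "grid_size n" and ?c = "grid_code (Suc n)"
  let ?G = "power_graph ?N"
  have V: "grid_params n 0 = {x \<in> {1..?N}. odd x}" "grid_params n 1 = grid_codes n"
    "grid_params n 2 = grid_codes n \<union> separators n"
    by (simp_all add: grid_params_def)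
  have x: "v 0 \<in> {1..?N}" and y: "v 1 \<in> {1..?N}"
    using v pq grid_code_in_range by metis+
  have neq: "v 0 \<noteq> v 1 \<longleftrightarrow> (p, q) \<noteq> (p', q')"
    using v pq by (simp add: grid_code_eq_iff)
  \<comment> \<open>Both numbers are even, hence not consecutive; only the valuation can make them
    adjacent.\<close>
  have edge: "(v 0, z) \<in> parcs ?G \<longleftrightarrow> z \<noteq> v 0 \<and> multiplicity 2 z = q"
    if "z \<in> grid_codes n" for z
  proof -
    from that obtain r s where z: "z = ?c (r, s)" and rs: "r \<in> {1..n}" "s \<in> {1..n}"
      by (auto simp: grid_codes_def)
    have "even z" "even (v 0)" using z v rs pq even_grid_code by auto
    then have "\<bar>int (v 0) - int z\<bar> \<noteq> 1"
      by (metis even_abs_add_iff even_add even_diff even_of_nat odd_one abs_eq_iff even_minus)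
    moreover have "z \<in> {1..?N}" using z rs grid_code_in_range by metis
    moreover have "multiplicity 2 (v 0) = q" using v pq by (simp add: multiplicity_grid_code)
    ultimately show ?thesis using x by auto
  qed
  have row: "sat ?G v (grid_params n) row_edge \<longleftrightarrow> p = p' \<and> (q' = q + 1 \<or> q = q' + 1)"
  proof -
    have "sat ?G v (grid_params n) row_edge \<longleftrightarrow> (p, q) \<noteq> (p', q') \<and>
        strictly_between (v 0) (v 1) \<inter> (grid_codes n \<union> separators n) = {}"
      unfolding row_edge_def using neq V x y by (auto simp: sat_reach)
    then show ?thesis using no_mark_strictly_between_iff[OF pq] unfolding v by auto
  qed
  have col: "sat ?G v (grid_params n) column_edge \<longleftrightarrow> q = q' \<and> (p' = p + 1 \<or> p = p' + 1)"
  proof -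
    have v1: "v 1 \<in> grid_codes n" using v pq by (auto simp: grid_codes_def)
    have mult: "multiplicity 2 (v 1) = q'" using v pq by (simp add: multiplicity_grid_code)
    \<comment> \<open>This discharges the condition \<open>z \<noteq> v 0\<close> in
      \<open>edge\<close> for every \<open>z\<close> in between, so adjacency there becomes equality
      of valuations.\<close>
    have "v 0 \<notin> strictly_between (v 0) (v 1)" by (simp add: strictly_between_def)
    moreover have "sat ?G v (grid_params n) (reach (Neg (Conj (Mem 2 1) (Edge 0 2)))) \<longleftrightarrow>
        (\<forall>z\<in>strictly_between (v 0) (v 1). \<not> (z \<in> grid_codes n \<and> (v 0, z) \<in> parcs ?G))"
      by (subst sat_reach) (use V x y in \<open>simp_all del: power_graph_simps\<close>)
    ultimately have "sat ?G v (grid_params n) column_edge \<longleftrightarrow> v 0 \<noteq> v 1 \<and> q' = q \<and>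
        (\<forall>z\<in>strictly_between (v 0) (v 1). \<not> (z \<in> grid_codes n \<and> multiplicity 2 z = q))"
      unfolding column_edge_def using edge v1 mult by (auto simp del: power_graph_simps)
    then show ?thesis
      using neq no_equal_valuation_strictly_between_iff[OF pq(1-3)] unfolding v by auto
  qed
  show ?thesis using pq by (auto simp: row col)
qed

text \<open>The isomorphism is \<open>grid_code (Suc n)\<close> itself.\<close>

lemma digraph_iso_grid_interp:
  "digraph_iso (with_proj (square_grid n))
     (with_proj (interp_graph grid_interp (power_graph (grid_size n)) (grid_params n)))"
    (is "digraph_iso _ (with_proj ?H)")
proof -
  let ?N = "grid_size n" and ?c = "grid_code (Suc n)"
  have verts: "interp_verts grid_interp (power_graph ?N) (grid_params n) = grid_codes n"
    using grid_params_subset[of n 1]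
    by (auto simp: interp_verts_def grid_interp_def grid_params_def)
  have edge_formula: "edge_formula grid_interp = Disj row_edge column_edge"
    by (simp add: grid_interp_def)
  have grid_wf: "pair_wf_digraph (square_grid n)"
    by unfold_locales auto
  have H_wf: "pair_wf_digraph ?H"
    by unfold_locales (auto simp: interp_graph_def)
  have "bij_betw ?c (pverts (square_grid n)) (pverts ?H)"
    by (auto simp: bij_betw_def inj_on_def interp_graph_def verts grid_codes_def grid_code_eq_iff)
  moreover have "(a, b) \<in> parcs (square_grid n) \<longleftrightarrow> (?c a, ?c b) \<in> parcs ?H"
    if ab: "a \<in> pverts (square_grid n)" "b \<in> pverts (square_grid n)" for a b
  proof -
    obtain p q p' q' where eq: "a = (p, q)" "b = (p', q')" by fastforce
    have "?c a \<in> grid_codes n" "?c b \<in> grid_codes n" using ab by (auto simp: grid_codes_def)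
    then show ?thesis
      using ab sat_grid_edge_iff[of p n q p' q' "\<lambda>x. if x = 0 then ?c a else ?c b"] unfolding eq
      by (simp add: interp_graph_def verts edge_formula
          del: square_grid_simps(2) Disj_simps(1))
  qed
  ultimately show ?thesis
    unfolding digraph_iso_pair_iff[OF grid_wf H_wf] by blast
qed

section \<open>Membership in the class and conclusion\<close>

lemma power_graph_in_Power_graphs:
  assumes "N \<ge> 1"
  shows "power_graph N \<in> Power_graphs"
proof -
  interpret pair_graph "power_graph N" by (rule pair_graph_power_graph)
  have "pair_wf_digraph (power_graph N)" ..
  then have "digraph_iso (with_proj (power_graph N)) (with_proj (power_graph N))"
    by (subst digraph_iso_pair_iff) (auto intro!: exI[of _ id])
  moreover have "induced_subgraph (with_proj (power_graph N)) (with_proj (power_graph N))"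
    by (rule induced_subgraph_refl)
  ultimately show ?thesis unfolding Power_graphs_def using assms by blast
qed

theorem theorem7:
  shows "\<exists>\<Theta>. mso_interpretation \<Theta> \<and>
    (\<forall>n\<ge>1. \<exists>H \<in> interp_class \<Theta> (Power_graphs :: nat pair_pre_digraph set).
      digraph_iso (with_proj (square_grid n)) (with_proj H))"
proof (intro exI conjI allI impI)
  show "mso_interpretation grid_interp" by (rule mso_interpretation_grid_interp)
next
  fix n :: nat
  let ?G = "power_graph (grid_size n)"
  have "?G \<in> Power_graphs" by (rule power_graph_in_Power_graphs) (simp add: grid_size_def Suc_le_eq)
  then have "interp_graph grid_interp ?G (grid_params n) \<in> interp_class grid_interp Power_graphs"
    unfolding interp_class_def using grid_params_subset[of n] by fastforce
  then show "\<exists>H \<in> interp_class grid_interp (Power_graphs :: nat pair_pre_digraph set).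
      digraph_iso (with_proj (square_grid n)) (with_proj H)"
    using digraph_iso_grid_interp by blast
qed

end
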